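(* Let $N$ be a set, let $n$ be a natural number, and let $\overline{X}=(X_1,\dots,X_n)$ and $\overline{Y}=(Y_1,\dots,Y_n)$ be $n$-tuples of nonempty subsets of $N$. Then $\overline{X}\sqsubseteq\overline{Y}$ if and only if there exists an increasing, contractive function $f:\mathbf{B}^n\to\mathbf{B}^n$ such that $\overline{X}\subseteq\widehat{f}(\overline{Y})$.
   Context: Sections and the preorder: an $n$-multiset of elements of $N$ is an orbit of the action of the symmetric group $S_n$ on $N^n$ by permuting coordinates. For an $n$-tuple $\overline{X}$ of nonempty subsets of $N$, $\mathcal{S}(\overline{X})$ is the set of all $n$-multisets that are orbits of tuples $(a_1,\dots,a_n)\in\prod_{1\le i\le n}X_i$. The relation $\overline{X}\sqsubseteq\overline{Y}$ means $\mathcal{S}(\overline{X})\subseteq\mathcal{S}(\overline{Y})$. The relation $\overline{X}\subseteq\overline{Z}$ between $n$-tuples of subsets of $N$ is pointwise inclusion: $X_i\subseteq Z_i$ for all $1\le i\le n$. Boolean operators: $\mathbf{B}=\{0,1\}$ with $0\le 1$, and $\mathbf{B}^n$ carries the pointwise order. The weight $|u|$ of $u\in\mathbf{B}^n$ is the number of $1$s in $u$. A function $f:\mathbf{B}^n\to\mathbf{B}^n$ is increasing if $u\le v$ implies $f(u)\le f(v)$; an increasing $f$ is contractive if $|f(u)|\le|u|$ for all $u\in\mathbf{B}^n$. Lifting: for $a\in N$ and an $n$-tuple $\overline{Y}$ of subsets of $N$, $\chi_{\overline{Y}}(a)\in\mathbf{B}^n$ is defined by $(\chi_{\overline{Y}}(a))_i=1$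 iff $a\in Y_i$. For $f:\mathbf{B}^n\to\mathbf{B}^n$, $\widehat{f}(\overline{Y})$ is the $n$-tuple of (possibly empty) subsets of $N$ whose $i$-th component is $\{a\in N : f(\chi_{\overline{Y}}(a)) \text{ has a } 1 \text{ at coordinate } i\}$. *)

theory Defs
  imports Main "HOL-Combinatorics.Permutations" "HOL-Library.FuncSet"
begin

text \<open>
  An \<open>n\<close>-tuple is a list of length \<open>n\<close>; the coordinates \<open>1, \<dots>, n\<close> are the
  list positions \<open>0, \<dots>, n - 1\<close>.
\<close>

definition tuples :: "nat \<Rightarrow> 'a set \<Rightarrow> 'a list set" where
  "tuples n A = {xs. length xs = n \<and> set xs \<subseteq> A}"

definition sym_orbit :: "'a list \<Rightarrow> 'a list set" where
  "sym_orbit xs = {permute_list p xs | p. p permutes {..<length xs}}"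

definition n_multisets :: "nat \<Rightarrow> 'a set \<Rightarrow> 'a list set set" where
  "n_multisets n N = sym_orbit ` tuples n N"

definition sections :: "'a set \<Rightarrow> 'a set list \<Rightarrow> 'a list set set" where
  "sections N X = {m \<in> n_multisets (length X) N. \<exists>a \<in> listset X. m = sym_orbit a}"

definition section_le :: "'a set \<Rightarrow> 'a set list \<Rightarrow> 'a set list \<Rightarrow> bool" where
  "section_le N X Y \<longleftrightarrow> sections N X \<subseteq> sections N Y"

definition tuple_subseteq :: "'a set list \<Rightarrow> 'a set list \<Rightarrow> bool" where
  "tuple_subseteq X Z \<longleftrightarrow> list_all2 (\<subseteq>) X Z"

text \<open>The two-element order \<open>0 \<le> 1\<close> is \<^typ>\<open>bool\<close>, with \<^term>\<open>False \<le> True\<close>.\<close>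

abbreviation cube :: "nat \<Rightarrow> bool list set" where
  "cube n \<equiv> tuples n UNIV"

definition cube_le :: "bool list \<Rightarrow> bool list \<Rightarrow> bool" where
  "cube_le u v \<longleftrightarrow> list_all2 (\<le>) u v"

definition weight :: "bool list \<Rightarrow> nat" where
  "weight u = count_list u True"

definition increasing :: "nat \<Rightarrow> (bool list \<Rightarrow> bool list) \<Rightarrow> bool" where
  "increasing n f \<longleftrightarrow> monotone_on (cube n) cube_le cube_le f"

definition contractive :: "nat \<Rightarrow> (bool list \<Rightarrow> bool list) \<Rightarrow> bool" where
  "contractive n f \<longleftrightarrow> increasing n f \<and> (\<forall>u \<in> cube n. weight (f u) \<le> weight u)"

definition chi :: "'a set list \<Rightarrow> 'a \<Rightarrow> bool list" where
  "chi Y a = map (\<lambda>S. a \<in> S) Y"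

definition lift :: "'a set \<Rightarrow> (bool list \<Rightarrow> bool list) \<Rightarrow> 'a set list \<Rightarrow> 'a set list" where
  "lift N f Y = map (\<lambda>i. {a \<in> N. f (chi Y a) ! i}) [0..<length Y]"

end

theory Submission
  imports Defs
begin

text \<open>
  A tuple \<open>b\<close> represents a section of \<open>Y\<close> iff its entries can be matched bijectively to the
  coordinates of \<open>Y\<close> containing them. If \<open>f\<close> is given and \<open>a \<in> \<Prod>X\<^sub>i\<close>, then for a set \<open>J\<close> of
  coordinates let \<open>u\<close> be the join of the vectors \<open>\<chi>(a\<^sub>i)\<close> with \<open>i \<in> J\<close>; monotonicity gives
  \<open>|J| \<le> |f(u)|\<close> and contractivity \<open>|f(u)| \<le> |u|\<close>, which is Hall's condition. Conversely, the least
  monotone candidate, whose value at \<open>u\<close> has a \<open>1\<close> at \<open>i\<close> iff \<open>\<chi>(a) \<le> u\<close> for some \<open>a \<in> X\<^sub>i\<close>, is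
  contractive: choosing such witnesses for all such \<open>i\<close> gives a section whose matching maps
  the support of \<open>f(u)\<close> injectively into that of \<open>u\<close>.
\<close>

section \<open>Hall's marriage theorem\<close>

definition hall_condition :: "'i set \<Rightarrow> ('i \<Rightarrow> 'b set) \<Rightarrow> bool" where
  "hall_condition I A \<longleftrightarrow> (\<forall>J\<subseteq>I. card J \<le> card (\<Union>i\<in>J. A i))"

lemma hall_conditionD: "hall_condition I A \<Longrightarrow> J \<subseteq> I \<Longrightarrow> card J \<le> card (\<Union>i\<in>J. A i)"
  by (simp add: hall_condition_def)

text \<open>A violating set must contain \<open>i\<close>, because the other members of the family
  are unchanged; dropping \<open>i\<close> from it turns the strict inequality into a weak
  one.\<close>

lemma hall_condition_remove_fail:
  assumes "finite I" and hall: "hall_condition I A" and "i \<in> I"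
    and fail: "\<not> hall_condition I (A(i := B))"
  obtains J where "J \<subseteq> I - {i}" "card ((\<Union>j\<in>J. A j) \<union> B) \<le> card J"
proof -
  from fail obtain K where K: "K \<subseteq> I" "card (\<Union>j\<in>K. (A(i := B)) j) < card K"
    by (auto simp: hall_condition_def not_le)
  have "i \<in> K"
  proof (rule ccontr)
    assume "i \<notin> K"
    then have "(\<Union>j\<in>K. (A(i := B)) j) = (\<Union>j\<in>K. A j)" by auto
    with K hall_conditionD[OF hall, of K] show False by simp
  qed
  have "finite K" using K(1) assms(1) by (rule finite_subset)
  have "(\<Union>j\<in>K. (A(i := B)) j) = (\<Union>j\<in>K - {i}. A j) \<union> B"
    using \<open>i \<in> K\<close> by (auto split: if_splits)
  with K \<open>i \<in> K\<close> \<open>finite K\<close> have "card ((\<Union>j\<in>K - {i}. A j) \<union> B) \<le> card (K - {i})"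
    by (simp add: card_Diff_singleton)
  with K(1) show thesis by (intro that[of "K - {i}"]) auto
qed

text \<open>Rado's argument: two critical sets would violate submodularity of \<open>J \<mapsto> |\<Union>\<^sub>j A\<^sub>j|\<close>.\<close>

lemma hall_condition_remove:
  assumes fin: "finite I" "\<And>j. j \<in> I \<Longrightarrow> finite (A j)" and hall: "hall_condition I A"
    and i: "i \<in> I" and "x \<noteq> y"
  shows "hall_condition I (A(i := A i - {x})) \<or> hall_condition I (A(i := A i - {y}))"
proof (rule ccontr)
  assume "\<not> ?thesis"
  then obtain J K where
    J: "J \<subseteq> I - {i}" "card ((\<Union>j\<in>J. A j) \<union> (A i - {x})) \<le> card J" and
    K: "K \<subseteq> I - {i}" "card ((\<Union>j\<in>K. A j) \<union> (A i - {y})) \<le> card K"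
    using hall_condition_remove_fail[OF fin(1) hall i] by metis
  let ?P = "(\<Union>j\<in>J. A j) \<union> (A i - {x})" and ?Q = "(\<Union>j\<in>K. A j) \<union> (A i - {y})"
  have finJK: "finite J" "finite K" using J(1) K(1) fin(1) by (meson finite_Diff finite_subset)+
  have finPQ: "finite ?P" "finite ?Q" using finJK J(1) K(1) fin(2) i by auto
  \<comment> \<open>The index \<open>i\<close> lies in neither \<open>J\<close> nor
    \<open>K\<close>, so inserting it supplies the extra 1 that makes the final count
    contradictory.\<close>
  have "card (insert i (J \<union> K)) \<le> card (\<Union>j\<in>insert i (J \<union> K). A j)"
    using J(1) K(1) i by (intro hall_conditionD[OF hall]) auto
  \<comment> \<open>As \<open>x\<close> and \<open>y\<close> differ, the two punctured copies of
    \<open>A i\<close> together cover \<open>A i\<close>.\<close>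
  also have "(\<Union>j\<in>insert i (J \<union> K). A j) = ?P \<union> ?Q" using \<open>x \<noteq> y\<close> by auto
  finally have "card (J \<union> K) + 1 \<le> card (?P \<union> ?Q)"
    using J(1) K(1) finJK by (subst (asm) card_insert_disjoint) auto
  moreover have "card (J \<inter> K) \<le> card (\<Union>j\<in>J \<inter> K. A j)"
    using J(1) by (intro hall_conditionD[OF hall]) auto
  moreover have "card (\<Union>j\<in>J \<inter> K. A j) \<le> card (?P \<inter> ?Q)"
    using finPQ by (intro card_mono) auto
  ultimately have "card J + card K + 1 \<le> card ?P + card ?Q"
    using card_Un_Int[OF finPQ] card_Un_Int[OF finJK] by linarith
  with J(2) K(2) show False by linarith
qed

text \<open>Induction on the total size: a member with two distinct elements can lose one of them by
  \<open>hall_condition_remove\<close>; once all members are singletons, the condition on pairs of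
  indices forces injectivity.\<close>

theorem hall_marriage:
  assumes "finite I" "\<And>i. i \<in> I \<Longrightarrow> finite (A i)" "hall_condition I A"
  shows "\<exists>g. inj_on g I \<and> (\<forall>i\<in>I. g i \<in> A i)"
  using assms
proof (induction "\<Sum>i\<in>I. card (A i)" arbitrary: A rule: less_induct)
  case less
  have nonempty: "1 \<le> card (A i)" if "i \<in> I" for i
    using hall_conditionD[OF less.prems(3), of "{i}"] that by simp
  show ?case
  proof (cases "\<exists>i\<in>I. card (A i) > 1")
    case True
    then obtain i x y where i: "i \<in> I" "x \<in> A i" "y \<in> A i" "x \<noteq> y"
      by (metis One_nat_def card.empty card_le_Suc0_iff_eq less.prems(2) not_le)
    have smaller: "(\<Sum>j\<in>I. card ((A(i := A i - {z})) j)) < (\<Sum>j\<in>I. card (A j))" if "z \<in> A i" for z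
    proof -
      have "card (A i - {z}) < card (A i)"
        using that i(1) less.prems(2) by (intro card_Diff1_less) auto
      then show ?thesis
        using i(1) less.prems(1) by (intro sum_strict_mono_ex1) (auto simp del: card_Diff_insert)
    qed
    obtain z where "z \<in> A i" "hall_condition I (A(i := A i - {z}))"
      using hall_condition_remove[OF less.prems i(1,4)] i(2,3) by blast
    then obtain g where "inj_on g I" "\<forall>j\<in>I. g j \<in> (A(i := A i - {z})) j"
      using less.hyps[OF smaller] less.prems by fastforce
    then show ?thesis by (metis Diff_iff fun_upd_apply)
  next
    case False
    then have "\<forall>i\<in>I. \<exists>b. A i = {b}"
      using nonempty by (metis card_1_singletonE le_antisym not_le)
    from bchoice[OF this] obtain g where g: "\<forall>i\<in>I. A i = {g i}" by blast
    have "inj_on g I"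
    proof (rule inj_onI, rule ccontr)
      fix i j assume ij: "i \<in> I" "j \<in> I" "g i = g j" "i \<noteq> j"
      then have "card {i, j} \<le> card (\<Union>k\<in>{i, j}. A k)"
        by (intro hall_conditionD[OF less.prems(3)]) auto
      with ij g show False by simp
    qed
    with g show ?thesis by auto
  qed
qed

section \<open>Sections and matchings\<close>

lemma in_listset_iff:
  "a \<in> listset X \<longleftrightarrow> length a = length X \<and> (\<forall>i<length X. a ! i \<in> X ! i)"
proof (induction X arbitrary: a)
  case (Cons A X)
  show ?case
    by (cases a) (auto simp: set_Cons_def Cons.IH All_less_Suc2)
qed simp

text \<open>Reduces equality of orbits to equality of multisets, from which
  \<open>mset_eq_permutation\<close> recovers a permutation.\<close>

lemma sym_orbit_eq: "sym_orbit xs = {ys. mset ys = mset xs}"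
proof
  show "{ys. mset ys = mset xs} \<subseteq> sym_orbit xs"
  proof
    fix ys assume "ys \<in> {ys. mset ys = mset xs}"
    then obtain p where "p permutes {..<length xs}" "permute_list p xs = ys"
      using mset_eq_permutation[of ys xs] by blast
    then show "ys \<in> sym_orbit xs" by (auto simp: sym_orbit_def)
  qed
qed (auto simp: sym_orbit_def)

lemma in_sections_iff:
  assumes "set Y \<subseteq> Pow N"
  shows "m \<in> sections N Y \<longleftrightarrow> (\<exists>b\<in>listset Y. m = sym_orbit b)"
proof -
  have "b \<in> tuples (length Y) N" if "b \<in> listset Y" for b
    using that assms by (fastforce simp: tuples_def in_listset_iff in_set_conv_nth)
  then show ?thesis unfolding sections_def n_multisets_def by blast
qed

text \<open>The matching is the permutation carrying a representative in \<open>listset Y\<close> to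
  \<open>a\<close>; conversely, an injection of a finite set into itself is a bijection.\<close>

lemma sym_orbit_in_sections_iff:
  assumes "set Y \<subseteq> Pow N" and len: "length a = length Y"
  shows "sym_orbit a \<in> sections N Y \<longleftrightarrow>
    (\<exists>g. inj_on g {..<length Y} \<and> (\<forall>i<length Y. g i < length Y \<and> a ! i \<in> Y ! g i))"
    (is "?L \<longleftrightarrow> ?R")
proof
  assume ?L
  then obtain b where b: "b \<in> listset Y" "mset a = mset b"
    using in_sections_iff[OF assms(1)] by (auto simp: sym_orbit_eq)
  then obtain p where p: "p permutes {..<length b}" "permute_list p b = a"
    using mset_eq_permutation[of a b] by blast
  have "length b = length Y" using b(1) by (simp add: in_listset_iff)
  moreover from this have "p i < length Y" if "i < length Y" for i
    using that permutes_in_image[OF p(1), of i] by simp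
  ultimately show ?R
    using p b(1) by (intro exI[of _ p]) (auto simp: in_listset_iff permute_list_nth permutes_inj_on)
next
  assume ?R
  then obtain g where g: "inj_on g {..<length Y}" "\<And>i. i < length Y \<Longrightarrow> g i < length Y"
      "\<And>i. i < length Y \<Longrightarrow> a ! i \<in> Y ! g i"
    by auto
  \<comment> \<open>A map that \<open>permutes\<close> the index range must be the identity outside
    it.\<close>
  define p where "p i = (if i < length Y then g i else i)" for i
  have "inj_on p {..<length Y}" "p ` {..<length Y} \<subseteq> {..<length Y}"
    using g by (auto simp: p_def inj_on_def)
  then have "bij_betw p {..<length Y} {..<length Y}"
    by (simp add: bij_betw_def endo_inj_surj)
  then have p: "p permutes {..<length Y}"
    by (rule bij_imp_permutes) (simp add: p_def)
  \<comment> \<open>Entry \<open>j\<close> of this list is \<open>a ! inv p j\<close>, which the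
    matching places in \<open>Y ! p (inv p j)\<close>, that is, in \<open>Y ! j\<close>.\<close>
  let ?b = "permute_list (inv p) a"
  have "?b \<in> listset Y"
  proof (unfold in_listset_iff, intro conjI allI impI)
    fix j assume "j < length Y"
    then have "inv p j < length Y"
      using permutes_in_image[OF permutes_inv[OF p]] by auto
    then have "a ! inv p j \<in> Y ! p (inv p j)" using g(3) by (simp add: p_def)
    then show "?b ! j \<in> Y ! j"
      using \<open>j < length Y\<close> p len by (simp add: permute_list_nth permutes_inv permutes_inverses)
  qed (simp add: len)
  moreover have "sym_orbit a = sym_orbit ?b"
    using permutes_inv[OF p] len by (simp add: sym_orbit_eq)
  ultimately show ?L using in_sections_iff[OF assms(1)] by blast
qed

lemma section_le_iff_matching:
  assumes "set X \<subseteq> Pow N" "set Y \<subseteq> Pow N" "length X = n" "length Y = n"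
  shows "section_le N X Y \<longleftrightarrow>
    (\<forall>a\<in>listset X. \<exists>g. inj_on g {..<n} \<and> (\<forall>i<n. g i < n \<and> a ! i \<in> Y ! g i))"
proof -
  have "section_le N X Y \<longleftrightarrow> (\<forall>a\<in>listset X. sym_orbit a \<in> sections N Y)"
    by (simp add: section_le_def subset_iff in_sections_iff[OF assms(1)]) blast
  then show ?thesis
    using sym_orbit_in_sections_iff[OF assms(2)] assms(3,4) by (simp add: in_listset_iff)
qed

section \<open>Boolean vectors\<close>

lemma weight_eq_card: "weight u = card {i. i < length u \<and> u ! i}"
  by (simp add: weight_def count_list_eq_length_filter length_filter_conv_card)

lemma cube_le_iff: "cube_le u v \<longleftrightarrow> length u = length v \<and> (\<forall>i<length u. u ! i \<longrightarrow> v ! i)"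
  by (simp add: cube_le_def list_all2_conv_all_nth)

lemma in_cube_iff: "u \<in> cube n \<longleftrightarrow> length u = n"
  by (simp add: tuples_def)

lemma length_chi [simp]: "length (chi Y a) = length Y"
  by (simp add: chi_def)

lemma chi_nth [simp]: "i < length Y \<Longrightarrow> chi Y a ! i \<longleftrightarrow> a \<in> Y ! i"
  by (simp add: chi_def)

lemma tuple_subseteq_lift_iff:
  assumes "set X \<subseteq> Pow N" "length X = length Y"
  shows "tuple_subseteq X (lift N f Y) \<longleftrightarrow> (\<forall>i<length Y. \<forall>a\<in>X ! i. f (chi Y a) ! i)"
proof -
  have "X ! i \<subseteq> N" if "i < length Y" for i
    using that assms by (metis PowD nth_mem subsetD)
  then show ?thesis
    using assms(2) by (fastforce simp: tuple_subseteq_def lift_def list_all2_conv_all_nth)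
qed

text \<open>Hall's theorem applied to the sets \<open>?A i\<close> of those coordinates of
  \<open>Y\<close> whose component contains \<open>a i\<close>.\<close>

lemma matching_of_contractive:
  assumes f: "f \<in> cube n \<rightarrow> cube n" "contractive n f" and len: "length Y = n"
    and a: "\<And>i. i < n \<Longrightarrow> f (chi Y (a i)) ! i"
  shows "\<exists>g. inj_on g {..<n} \<and> (\<forall>i<n. g i < n \<and> a i \<in> Y ! g i)"
proof -
  let ?A = "\<lambda>i. {j. j < n \<and> a i \<in> Y ! j}"
  have "hall_condition {..<n} ?A"
    unfolding hall_condition_def
  proof (intro allI impI)
    fix J assume J: "J \<subseteq> {..<n}"
    \<comment> \<open>The support of \<open>u\<close> is the union of the \<open>?A i\<close> with
      \<open>i \<in> J\<close>, so \<open>weight u\<close> is the right-hand side of Hall's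
      condition.\<close>
    define u where "u = map (\<lambda>j. \<exists>i\<in>J. a i \<in> Y ! j) [0..<n]"
    have u: "u \<in> cube n" by (simp add: u_def in_cube_iff)
    then have fu: "length (f u) = n" using f(1) by (auto simp: in_cube_iff)
    have "f u ! i" if "i \<in> J" for i
    proof -
      have "cube_le (chi Y (a i)) u" using that len by (auto simp: cube_le_iff u_def)
      moreover have chi: "chi Y (a i) \<in> cube n" by (simp add: in_cube_iff len)
      ultimately have "cube_le (f (chi Y (a i))) (f u)"
        using f(2) u by (auto simp: contractive_def increasing_def monotone_on_def)
      with a[of i] that J fu show ?thesis by (auto simp: cube_le_iff)
    qed
    with J fu have "card J \<le> weight (f u)"
      unfolding weight_eq_card by (intro card_mono) auto
    also have "\<dots> \<le> weight u" using f(2) u by (simp add: contractive_def)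
    also have "\<dots> = card (\<Union>i\<in>J. ?A i)"
      unfolding weight_eq_card by (rule arg_cong[where f = card]) (auto simp: u_def)
    finally show "card J \<le> card (\<Union>i\<in>J. ?A i)" .
  qed
  from hall_marriage[OF _ _ this] show ?thesis by auto
qed

text \<open>Each 1 here is forced: if \<open>f\<close> is increasing and
  \<open>tuple_subseteq X (lift N f Y)\<close> holds, then \<open>f (chi Y a) ! i\<close> for every
  \<open>a \<in> X ! i\<close>, and this 1 persists at every \<open>u\<close> above
  \<open>chi Y a\<close>.\<close>

definition least_operator :: "'a set list \<Rightarrow> 'a set list \<Rightarrow> bool list \<Rightarrow> bool list" where
  "least_operator X Y u = map (\<lambda>S. \<exists>a\<in>S. cube_le (chi Y a) u) X"

lemma increasing_least_operator: "increasing n (least_operator X Y)"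
  unfolding increasing_def
proof (rule monotone_onI)
  fix u v assume "cube_le u v"
  then have "cube_le (chi Y a) v" if "cube_le (chi Y a) u" for a
    using that by (simp add: cube_le_iff)
  then show "cube_le (least_operator X Y u) (least_operator X Y v)"
    unfolding least_operator_def by (subst cube_le_iff) auto
qed

lemma contractive_least_operator:
  assumes len: "length X = n" "length Y = n" and "{} \<notin> set X"
    and matching: "\<And>a. a \<in> listset X \<Longrightarrow>
      \<exists>g. inj_on g {..<n} \<and> (\<forall>i<n. g i < n \<and> a ! i \<in> Y ! g i)"
  shows "contractive n (least_operator X Y)"
  unfolding contractive_def
proof (intro conjI ballI increasing_least_operator)
  fix u assume "u \<in> cube n"
  then have u: "length u = n" by (simp add: in_cube_iff)
  let ?f = "least_operator X Y"
  \<comment> \<open>The implication lets coordinates where \<open>?f u\<close> is 0 take any element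
    of \<open>X ! i\<close>, so that the choices form a full section of \<open>X\<close>.\<close>
  have "\<exists>x\<in>X ! i. ?f u ! i \<longrightarrow> cube_le (chi Y x) u" if "i < n" for i
  proof -
    have "X ! i \<noteq> {}" using that len assms(3) nth_mem by metis
    then show ?thesis using that len by (auto simp: least_operator_def)
  qed
  then obtain x where x: "\<And>i. i < n \<Longrightarrow> x i \<in> X ! i"
      "\<And>i. i < n \<Longrightarrow> ?f u ! i \<Longrightarrow> cube_le (chi Y (x i)) u"
    by metis
  have "map x [0..<n] \<in> listset X" using x(1) len by (simp add: in_listset_iff)
  from matching[OF this] obtain g where
    g: "inj_on g {..<n}" "\<And>i. i < n \<Longrightarrow> g i < n" "\<And>i. i < n \<Longrightarrow> x i \<in> Y ! g i"
    by auto
  let ?F = "{i. i < n \<and> ?f u ! i}"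
  \<comment> \<open>\<open>x i \<in> Y ! g i\<close> says that \<open>chi Y (x i)\<close> has a 1 at
    \<open>g i\<close>; for \<open>i \<in> ?F\<close> this vector lies below
    \<open>u\<close>.\<close>
  have "g ` ?F \<subseteq> {j. j < n \<and> u ! j}"
    using g x(2) len by (auto simp: cube_le_iff)
  moreover have "inj_on g ?F" using g(1) by (rule inj_on_subset) auto
  ultimately have "card ?F \<le> card {j. j < n \<and> u ! j}"
    by (intro card_inj_on_le) auto
  then show "weight (?f u) \<le> weight u"
    using u len by (simp add: weight_eq_card least_operator_def)
qed

theorem proposition3:
  fixes N :: "'a set" and n :: nat and X Y :: "'a set list"
  assumes "X \<in> tuples n (Pow N - {{}})"
    and "Y \<in> tuples n (Pow N - {{}})"
  shows "section_le N X Y \<longleftrightarrow>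
    (\<exists>f \<in> cube n \<rightarrow> cube n. increasing n f \<and> contractive n f \<and> tuple_subseteq X (lift N f Y))"
proof -
  have X: "set X \<subseteq> Pow N" "length X = n" "{} \<notin> set X"
    and Y: "set Y \<subseteq> Pow N" "length Y = n"
    using assms by (auto simp: tuples_def)
  note le_iff = section_le_iff_matching[OF X(1) Y(1) X(2) Y(2)]
  have lift_iff: "tuple_subseteq X (lift N f Y) \<longleftrightarrow> (\<forall>i<n. \<forall>a\<in>X ! i. f (chi Y a) ! i)" for f
    using tuple_subseteq_lift_iff[OF X(1), of Y f] X(2) Y(2) by simp
  show ?thesis
  proof
    assume "section_le N X Y"
    then have "contractive n (least_operator X Y)"
      using contractive_least_operator[OF X(2) Y(2) X(3)] le_iff by blast
    moreover have "least_operator X Y \<in> cube n \<rightarrow> cube n"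
      using X(2) by (simp add: in_cube_iff least_operator_def)
    \<comment> \<open>Each \<open>a \<in> X ! i\<close> is its own witness, by reflexivity of
      \<open>cube_le\<close> at \<open>chi Y a\<close>.\<close>
    moreover have "tuple_subseteq X (lift N (least_operator X Y) Y)"
      unfolding lift_iff using X(2) by (auto simp: least_operator_def cube_le_iff)
    ultimately show "\<exists>f \<in> cube n \<rightarrow> cube n.
        increasing n f \<and> contractive n f \<and> tuple_subseteq X (lift N f Y)"
      using increasing_least_operator by blast
  next
    assume "\<exists>f \<in> cube n \<rightarrow> cube n.
        increasing n f \<and> contractive n f \<and> tuple_subseteq X (lift N f Y)"
    then obtain f where f: "f \<in> cube n \<rightarrow> cube n" "contractive n f"
        "\<And>i a. i < n \<Longrightarrow> a \<in> X ! i \<Longrightarrow> f (chi Y a) ! i"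
      unfolding lift_iff by blast
    show "section_le N X Y"
      unfolding le_iff
    proof
      fix a assume "a \<in> listset X"
      then show "\<exists>g. inj_on g {..<n} \<and> (\<forall>i<n. g i < n \<and> a ! i \<in> Y ! g i)"
        using X(2) f(3) by (intro matching_of_contractive[OF f(1,2) Y(2)]) (simp add: in_listset_iff)
    qed
  qed
qed

end
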